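(* Let $d,J\in\mathbb{N}$, let $H_1,\dots,H_J:\mathbb{R}^d\to\mathbb{R}$ be convex, put $H(p)=\min_{1\le j\le J}H_j(p)$, and let $f:\mathbb{R}^d_+\to\mathbb{R}$ and $g:[0,1]\times\mathbb{R}^d_+\to\mathbb{R}$ be bounded and continuous. Let $\gamma_1,\dots,\gamma_d\in\mathbb{R}^d$ be linearly independent vectors with $\langle\gamma_i,e_i\rangle=1$ for all $i$, and assume that there exists a compact, convex, symmetric set $B\subset\mathbb{R}^d$ with $0\in B^\circ$ such that, whenever $z\in\partial B$ and $n$ is an outward normal to $B$ at $z$, for all $i\in\{1,\dots,d\}$: $\langle z,e_i\rangle\ge -1$ implies $\langle\gamma_i,n\rangle\ge 0$, and $\langle z,e_i\rangle\le 1$ implies $\langle\gamma_i,n\rangle\le 0$. Let $u$ be a viscosity subsolution and $v$ a viscosity supersolution (as defined in the context) of the problem $$\max\{-V_t(t,x)-H(DV(t,x));\,V(t,x)-g(t,x)\}=0,\quad t\in(0,1),\ x\in(\mathbb{R}^d_+)^\circ,$$ $$\langle DV(t,x),\gamma_i\rangle=0,\quad t\in(0,1),\ i\in I(x),\ x\in\partial\mathbb{R}^d_+,$$ $$V(t,0)=0,\ t\in[0,1];\qquad V(1,x)=f(x),\ x\in\mathbb{R}^d_+\setminus\{0\}.$$ Then $u\le v$ on $[0,1]\times\mathbb{R}^d_+$.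
   Context: $\mathbb{R}^d_+=\{x\in\mathbb{R}^d:x_i\ge 0,\ i=1,\dots,d\}$; $e_i$ is the $i$-th standard unit vector; $I(x)=\{i:x_i=0\}$ for $x\in\mathbb{R}^d_+$. A set $B$ is symmetric if $x\in B\Rightarrow -x\in B$. $D$ denotes the gradient in the spatial variable, the subscript $t$ the partial derivative in time. $a\wedge b$ and $a\vee b$ are minimum and maximum. A minimum over an empty index set is $+\infty$ and a maximum over an empty index set is $-\infty$ (so for $y$ in the interior the terms indexed by $I(y)$ are absent). Viscosity sub/supersolutions: a bounded Lipschitz continuous function $w:[0,1]\times\mathbb{R}^d_+\to\mathbb{R}$ is a viscosity subsolution [resp. supersolution] of the problem if: (i) whenever $\theta:(0,1)\times\mathbb{R}^d_+\to\mathbb{R}$ is continuously differentiable and $(s,y)\in(0,1)\times(\mathbb{R}^d_+\setminus\{0\})$ is a local maximum [resp. local minimum] of $w-\theta$, then $$\max\Big\{\Big([-\theta_t(s,y)-H(D\theta(s,y))]\wedge\min_{i\in I(y)}[-\langle D\theta(s,y),\gamma_i\rangle]\Big);\,w(s,y)-g(s,y)\Big\}\le 0$$ [resp. $$\max\Big\{\Big([-\theta_t(s,y)-H(D\theta(s,y))]\vee\max_{i\in I(y)}[-\langle D\theta(s,y),\gamma_i\rangle]\Big);\,w(s,y)-g(s,y)\Big\}\ge 0\,];$$ (ii) $w(t,0)=0$ for all $t\in[0,1]$; (iii) $w(1,x)\le f(x)$ [resp. $w(1,x)\ge f(x)$] for all $x\in\mathbb{R}^d_+\setminus\{0\}$.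 *)

theory Defs
  imports "HOL-Analysis.Analysis"
begin

definition orthant :: "(real^'d) set" where
  "orthant = {x. \<forall>i. 0 \<le> x $ i}"

definition zero_coords :: "real^'d \<Rightarrow> 'd set" where
  "zero_coords x = {i. x $ i = 0}"

text \<open>Functions of time and space take a pair \<open>(t, x)\<close>. A test function is continuously
  differentiable up to the boundary of the orthant, so derivatives are taken within
  \<open>(0,1) \<times> orthant\<close>; they are unique there (see \<open>test_function_unique\<close> below).\<close>

definition test_function ::
  "(real \<times> (real^'d) \<Rightarrow> real) \<Rightarrow> (real \<times> (real^'d) \<Rightarrow> real) \<Rightarrow> (real \<times> (real^'d) \<Rightarrow> real^'d) \<Rightarrow> bool" where
  "test_function \<theta> \<theta>t D\<theta> \<longleftrightarrow>
     continuous_on ({0<..<1} \<times> orthant) \<theta>t \<and>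
     continuous_on ({0<..<1} \<times> orthant) D\<theta> \<and>
     (\<forall>q \<in> {0<..<1} \<times> orthant.
        (\<theta> has_derivative (\<lambda>(h, k). \<theta>t q * h + D\<theta> q \<bullet> k)) (at q within {0<..<1} \<times> orthant))"

definition local_max_on :: "'a::metric_space set \<Rightarrow> ('a \<Rightarrow> real) \<Rightarrow> 'a \<Rightarrow> bool" where
  "local_max_on S \<phi> p \<longleftrightarrow> p \<in> S \<and> (\<exists>\<epsilon>>0. \<forall>q\<in>S. dist q p < \<epsilon> \<longrightarrow> \<phi> q \<le> \<phi> p)"

definition local_min_on :: "'a::metric_space set \<Rightarrow> ('a \<Rightarrow> real) \<Rightarrow> 'a \<Rightarrow> bool" where
  "local_min_on S \<phi> p \<longleftrightarrow> p \<in> S \<and> (\<exists>\<epsilon>>0. \<forall>q\<in>S. dist q p < \<epsilon> \<longrightarrow> \<phi> p \<le> \<phi> q)"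

definition bounded_lipschitz :: "(real \<times> (real^'d) \<Rightarrow> real) \<Rightarrow> bool" where
  "bounded_lipschitz w \<longleftrightarrow>
     bounded (w ` ({0..1} \<times> orthant)) \<and> (\<exists>L. L-lipschitz_on ({0..1} \<times> orthant) w)"

text \<open>The inequalities live in \<^typ>\<open>ereal\<close>, where \<open>INF\<close> and \<open>SUP\<close> over the empty
  index set are \<open>\<infinity>\<close> and \<open>-\<infinity>\<close>, and over a finite nonempty index set
  are the minimum and the maximum.\<close>

definition viscosity_subsolution ::
  "(real^'d \<Rightarrow> real) \<Rightarrow> (real^'d \<Rightarrow> real) \<Rightarrow> (real \<times> (real^'d) \<Rightarrow> real) \<Rightarrow> ('d \<Rightarrow> real^'d) \<Rightarrow>
   (real \<times> (real^'d) \<Rightarrow> real) \<Rightarrow> bool" where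
  "viscosity_subsolution H f g \<gamma> w \<longleftrightarrow>
     bounded_lipschitz w \<and>
     (\<forall>\<theta> \<theta>t D\<theta> s y.
        test_function \<theta> \<theta>t D\<theta> \<longrightarrow> s \<in> {0<..<1} \<longrightarrow> y \<in> orthant - {0} \<longrightarrow>
        local_max_on ({0<..<1} \<times> orthant) (\<lambda>q. w q - \<theta> q) (s, y) \<longrightarrow>
        max (min (ereal (- \<theta>t (s, y) - H (D\<theta> (s, y))))
                 (INF i\<in>zero_coords y. ereal (- (D\<theta> (s, y) \<bullet> \<gamma> i))))
            (ereal (w (s, y) - g (s, y))) \<le> 0) \<and>
     (\<forall>t\<in>{0..1}. w (t, 0) = 0) \<and>
     (\<forall>x\<in>orthant - {0}. w (1, x) \<le> f x)"

definition viscosity_supersolution ::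
  "(real^'d \<Rightarrow> real) \<Rightarrow> (real^'d \<Rightarrow> real) \<Rightarrow> (real \<times> (real^'d) \<Rightarrow> real) \<Rightarrow> ('d \<Rightarrow> real^'d) \<Rightarrow>
   (real \<times> (real^'d) \<Rightarrow> real) \<Rightarrow> bool" where
  "viscosity_supersolution H f g \<gamma> w \<longleftrightarrow>
     bounded_lipschitz w \<and>
     (\<forall>\<theta> \<theta>t D\<theta> s y.
        test_function \<theta> \<theta>t D\<theta> \<longrightarrow> s \<in> {0<..<1} \<longrightarrow> y \<in> orthant - {0} \<longrightarrow>
        local_min_on ({0<..<1} \<times> orthant) (\<lambda>q. w q - \<theta> q) (s, y) \<longrightarrow>
        max (max (ereal (- \<theta>t (s, y) - H (D\<theta> (s, y))))
                 (SUP i\<in>zero_coords y. ereal (- (D\<theta> (s, y) \<bullet> \<gamma> i))))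
            (ereal (w (s, y) - g (s, y))) \<ge> 0) \<and>
     (\<forall>t\<in>{0..1}. w (t, 0) = 0) \<and>
     (\<forall>x\<in>orthant - {0}. w (1, x) \<ge> f x)"

definition outward_normal :: "(real^'d) set \<Rightarrow> real^'d \<Rightarrow> real^'d \<Rightarrow> bool" where
  "outward_normal B z n \<longleftrightarrow> n \<noteq> 0 \<and> (\<forall>x\<in>B. n \<bullet> (x - z) \<le> 0)"

lemma test_function_unique:
  fixes \<theta> :: "real \<times> (real^'d) \<Rightarrow> real"
  assumes "test_function \<theta> a A" "test_function \<theta> b B" and q: "q \<in> {0<..<1} \<times> orthant"
  shows "a q = b q \<and> A q = B q"
proof -
  let ?S = "{0<..<1} \<times> (orthant :: (real^'d) set)"
  have d1: "(\<theta> has_derivative (\<lambda>(h, k). a q * h + A q \<bullet> k)) (at q within ?S)"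
   and d2: "(\<theta> has_derivative (\<lambda>(h, k). b q * h + B q \<bullet> k)) (at q within ?S)"
    using assms by (auto simp: test_function_def)
  have "\<exists>d. 0 < \<bar>d\<bar> \<and> \<bar>d\<bar> < e \<and> q + d *\<^sub>R v \<in> ?S" if v: "v \<in> Basis" and e: "e > 0" for v e
  proof -
    obtain s y where sy: "q = (s, y)" by (cases q)
    have s: "0 < s" "s < 1" and y: "y \<in> orthant" using q sy by auto
    define d where "d = min (e / 2) ((1 - s) / 2)"
    have d: "0 < d" "d < e" "s + d < 1" using e s by (auto simp: d_def min_def field_simps)
    from v consider "v = (1, 0)" | i where "v = (0, axis i 1)"
      by (auto simp: Basis_prod_def Basis_vec_def)
    then have "q + d *\<^sub>R v \<in> ?S"
    proof cases
      case 1
      then show ?thesis using d s y by (simp add: sy)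
    next
      case 2
      then show ?thesis using d s y by (auto simp: sy orthant_def axis_def)
    qed
    then show ?thesis using d by (intro exI[of _ d]) auto
  qed
  then have "(\<lambda>(h, k). a q * h + A q \<bullet> k) = (\<lambda>(h, k). b q * h + B q \<bullet> k)"
    by (intro frechet_derivative_unique_within[OF d1 d2]) auto
  then have eq: "a q * h + A q \<bullet> k = b q * h + B q \<bullet> k" for h k
    by (metis (mono_tags, lifting) case_prod_conv)
  have "a q = b q" using eq[of 1 0] by simp
  moreover have "A q = B q" using eq[of 0] by (intro vector_eq_rdot[THEN iffD1]) simp
  ultimately show ?thesis by simp
qed

end

theory Submission
  imports Defs
begin

text \<open>
  Suppose \<open>u - v\<close> is positive somewhere. The classical argument doubles the variables and
  maximizes \<open>u (t, x) - v (s, y)\<close> minus a penalty that forces the two points together; at the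
  maximum the penalty supplies test functions for both \<open>u\<close> and \<open>v\<close> with almost equal gradients,
  and a further strict term in time yields a contradiction. Two difficulties are specific to this
  problem: on the faces of the orthant the oblique reflection condition must not be the one that
  is satisfied, and the domain is unbounded.

  The set \<open>B\<close> resolves both. The squared distance to a closed convex set is continuously
  differentiable whatever the regularity of its boundary (\<open>has_derivative_sq_dist_to\<close>), and its
  gradient is a multiple of an outward normal. For the dilated set \<open>\<rho> B\<close> the slack in the
  hypothesis on normals implies that, at distance at most \<open>\<rho>\<close>, the gradient has the right sign
  along each reflection direction (\<open>oblique_normals_gradient\<close>). The parts of the penalty are
  chosen accordingly.

  \<^item> The gluing penalty is \<open>dist\<^sup>2 (x - y, \<rho> B) / (c \<rho>)\<close>, together with the corresponding term in
  time. It vanishes only within a distance of order \<open>\<rho>\<close> of the diagonal, and for small fixed \<open>c\<close>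
  the Lipschitz continuity of \<open>v\<close> keeps the distance to \<open>\<rho> B\<close> below \<open>\<rho>\<close> at the maximum
  (\<open>penalty_forces_proximity\<close>). Its gradient there is bounded by \<open>2 / c\<close>, uniformly in \<open>\<rho>\<close>.

  \<^item> The growth penalty is \<open>A dist\<^sup>2 (x, R B) / R\<^sup>2\<close> with \<open>A\<close> above the oscillation of the
  solutions. It confines the maximum to distance less than \<open>R\<close>, and its gradient there is of
  order \<open>A / R\<close>.

  \<^item> Linear terms \<open>\<delta> (q \<bullet> x)\<close> and \<open>\<delta> (q \<bullet> y)\<close> with \<open>q \<bullet> \<gamma> i = -1\<close> for all \<open>i\<close> make the
  signs on the faces strict, so that the equation itself holds at the maximum for both functions.

  All momenta lie in a fixed ball, on which the Hamiltonian, a minimum of finitely many convex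
  and hence continuous functions, is uniformly continuous: the two Hamiltonians almost agree.
  The time penalty \<open>\<eta> / t\<close> gives the strict gain and keeps the maximum away from time \<open>0\<close>;
  terminal time and the origin are excluded by the ordering of the boundary values, and the
  obstacle by the uniform continuity of \<open>g\<close> on compact sets.
\<close>

section \<open>The squared distance to a convex set\<close>

definition sq_dist_to :: "'a::euclidean_space set \<Rightarrow> 'a \<Rightarrow> real" where
  "sq_dist_to C z = (norm (z - closest_point C z))\<^sup>2"

lemma sq_dist_to_le:
  assumes "closed C" "p \<in> C"
  shows "sq_dist_to C z \<le> (norm (z - p))\<^sup>2"
  unfolding sq_dist_to_def using closest_point_le[OF assms, of z]
  by (intro power_mono) (auto simp: dist_norm)

text \<open>The residual is the identity minus the nonexpansive projection, hence the
  constant \<open>2\<close>.\<close>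

lemma norm_minus_closest_point_lipschitz:
  fixes C :: "'a::euclidean_space set"
  assumes "closed C" "convex C" "C \<noteq> {}"
  shows "norm ((w - closest_point C w) - (z - closest_point C z)) \<le> 2 * norm (w - z)"
proof -
  have "norm (closest_point C w - closest_point C z) \<le> norm (w - z)"
    using closest_point_lipschitz[OF assms(2,1,3), of w z] by (simp add: dist_norm)
  moreover have "norm ((w - z) - (closest_point C w - closest_point C z)) \<le>
      norm (w - z) + norm (closest_point C w - closest_point C z)"
    by (rule norm_triangle_ineq4)
  ultimately show ?thesis by (simp add: algebra_simps)
qed

text \<open>The point of using squared distances: however rough the boundary of \<open>C\<close> is, they are
  continuously differentiable, because the projection onto \<open>C\<close> may be frozen at first order.
  Testing the distance from \<open>w\<close> with the projection of \<open>z\<close>, and the distance from \<open>z\<close> with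
  the projection of \<open>w\<close>, bounds the increment from both sides up to a quadratic error.\<close>

lemma has_derivative_sq_dist_to:
  fixes C :: "'a::euclidean_space set"
  assumes C: "closed C" "convex C" "C \<noteq> {}"
  shows "(sq_dist_to C has_derivative (\<lambda>h. (2 *\<^sub>R (z - closest_point C z)) \<bullet> h)) (at z)"
proof (rule has_derivativeI_sandwich[where e = 1 and H = "\<lambda>w. 5 * norm (w - z)"])
  show "bounded_linear (\<lambda>h. (2 *\<^sub>R (z - closest_point C z)) \<bullet> h)"
    by (rule bounded_linear_inner_right)
  show "((\<lambda>w. 5 * norm (w - z)) \<longlongrightarrow> 0) (at z)"
    by (auto intro!: tendsto_eq_intros)
  fix w assume "w \<noteq> z"
  define a where "a = z - closest_point C z"
  define b where "b = w - closest_point C w"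
  define h where "h = w - z"
  have ab: "norm (b - a) \<le> 2 * norm h"
    unfolding a_def b_def h_def by (rule norm_minus_closest_point_lipschitz[OF C])
  have cp: "closest_point C v \<in> C" for v
    using C(1,3) by (rule closest_point_in_set)
  have "sq_dist_to C w \<le> (norm (w - closest_point C z))\<^sup>2"
    by (rule sq_dist_to_le[OF C(1) cp])
  also have "w - closest_point C z = a + h" by (simp add: a_def h_def)
  finally have up: "sq_dist_to C w \<le> sq_dist_to C z + 2 * (a \<bullet> h) + (norm h)\<^sup>2"
    by (simp add: sq_dist_to_def a_def[symmetric] power2_norm_eq_inner inner_add inner_commute)
  have "sq_dist_to C z \<le> (norm (z - closest_point C w))\<^sup>2"
    by (rule sq_dist_to_le[OF C(1) cp])
  also have "z - closest_point C w = b - h" by (simp add: b_def h_def)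
  finally have lo: "sq_dist_to C z \<le> sq_dist_to C w - 2 * (b \<bullet> h) + (norm h)\<^sup>2"
    by (simp add: sq_dist_to_def b_def[symmetric] power2_norm_eq_inner inner_diff inner_commute)
  have "\<bar>(b - a) \<bullet> h\<bar> \<le> norm (b - a) * norm h"
    by (rule Cauchy_Schwarz_ineq2)
  also have "\<dots> \<le> 2 * norm h * norm h"
    using ab by (rule mult_right_mono) simp
  finally have "\<bar>b \<bullet> h - a \<bullet> h\<bar> \<le> 2 * (norm h)\<^sup>2"
    by (simp add: power2_eq_square inner_diff_left)
  with up lo have "\<bar>sq_dist_to C w - sq_dist_to C z - 2 * (a \<bullet> h)\<bar> \<le> 5 * (norm h)\<^sup>2"
    by auto
  then show "norm (sq_dist_to C w - sq_dist_to C z - (2 *\<^sub>R (z - closest_point C z)) \<bullet> (w - z)) / norm (w - z)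
      \<le> 5 * norm (w - z)"
    using \<open>w \<noteq> z\<close> by (simp add: a_def h_def divide_le_eq power2_eq_square)
qed simp

lemma continuous_on_minus_closest_point:
  fixes C :: "'a::euclidean_space set"
  assumes "closed C" "convex C" "C \<noteq> {}"
  shows "continuous_on S (\<lambda>z. z - closest_point C z)"
  using assms by (intro continuous_intros continuous_on_closest_point)

lemma continuous_on_sq_dist_to [continuous_intros]:
  fixes C :: "'a::euclidean_space set"
  assumes "closed C" "convex C" "C \<noteq> {}" "continuous_on S h"
  shows "continuous_on S (\<lambda>z. sq_dist_to C (h z))"
  unfolding sq_dist_to_def
  by (intro continuous_intros continuous_on_compose2[OF continuous_on_minus_closest_point[OF assms(1-3)] assms(4)]) auto

section \<open>Distances to multiples of the reflection-compatible set\<close>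

lemma norm_le_closest_point_scaled:
  fixes B :: "'a::euclidean_space set"
  assumes "closed B" "B \<noteq> {}" "\<And>z. z \<in> B \<Longrightarrow> norm z \<le> b" "\<rho> > 0"
  shows "norm z \<le> norm (z - closest_point ((*\<^sub>R) \<rho> ` B) z) + \<rho> * b"
proof -
  let ?p = "closest_point ((*\<^sub>R) \<rho> ` B) z"
  have "?p \<in> (*\<^sub>R) \<rho> ` B"
    using assms by (intro closest_point_in_set closed_scaling) auto
  then obtain p where "p \<in> B" "?p = \<rho> *\<^sub>R p" by auto
  then have "norm ?p \<le> \<rho> * b" using assms by simp
  then show ?thesis using norm_triangle_sub[of z ?p] by linarith
qed

lemma outward_normal_imp_frontier:
  fixes z n :: "real^'d"
  assumes "z \<in> B" "outward_normal B z n"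
  shows "z \<in> frontier B"
proof -
  have "z \<notin> interior B"
  proof
    assume "z \<in> interior B"
    then obtain e where e: "e > 0" "cball z e \<subseteq> B"
      by (auto simp: mem_interior_cball)
    have n: "norm n > 0" using assms(2) by (simp add: outward_normal_def)
    then have "z + (e / norm n) *\<^sub>R n \<in> B"
      using e by (intro subsetD[OF e(2)]) (simp add: dist_norm)
    with assms(2) have "n \<bullet> ((e / norm n) *\<^sub>R n) \<le> 0"
      unfolding outward_normal_def by (metis add_diff_cancel_left')
    moreover have "n \<bullet> ((e / norm n) *\<^sub>R n) > 0" using n e by simp
    ultimately show False by simp
  qed
  with assms(1) show ?thesis using closure_subset by (auto simp: frontier_def)
qed

text \<open>The compatibility of \<open>B\<close> with the reflection directions. A face \<open>x\<^sub>i = 0\<close> sees the difference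
  \<open>x - y\<close> of two points of the orthant with a definite sign of its \<open>i\<close>-th coordinate; the normals
  of \<open>B\<close> then have the sign along \<open>\<gamma> i\<close> that a reflection argument needs. The slack up to
  \<open>\<plusminus>1\<close> instead of \<open>0\<close> allows normals at projections of points outside \<open>B\<close>, whose coordinates are slightly shifted.\<close>

definition oblique_normals :: "('d \<Rightarrow> real^'d) \<Rightarrow> (real^'d) set \<Rightarrow> bool" where
  "oblique_normals \<gamma> B \<longleftrightarrow>
     (\<forall>z\<in>frontier B. \<forall>n. outward_normal B z n \<longrightarrow>
             (\<forall>i. (z \<bullet> axis i 1 \<ge> -1 \<longrightarrow> \<gamma> i \<bullet> n \<ge> 0) \<and>
                  (z \<bullet> axis i 1 \<le> 1 \<longrightarrow> \<gamma> i \<bullet> n \<le> 0)))"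

text \<open>The gradient of the squared distance to \<open>\<rho> B\<close> is a nonnegative multiple of an outward normal
  of \<open>B\<close> at \<open>p / \<rho>\<close>, where \<open>p\<close> is the projection of \<open>z\<close>. As long as the distance is at most
  \<open>\<rho>\<close>, the coordinates of \<open>p / \<rho>\<close> and \<open>z / \<rho>\<close> differ by at most \<open>1\<close>, which is exactly the
  slack in the hypothesis on \<open>B\<close>: the sign of \<open>z $ i\<close> decides the sign along \<open>\<gamma> i\<close>.\<close>

lemma oblique_normals_gradient:
  fixes z :: "real^'d"
  assumes B: "closed B" "convex B" "B \<noteq> {}" "oblique_normals \<gamma> B" and \<rho>: "\<rho> > 0"
    and near: "norm (z - closest_point ((*\<^sub>R) \<rho> ` B) z) \<le> \<rho>"
  shows "z $ i \<le> 0 \<Longrightarrow> (z - closest_point ((*\<^sub>R) \<rho> ` B) z) \<bullet> \<gamma> i \<le> 0"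
    and "z $ i \<ge> 0 \<Longrightarrow> (z - closest_point ((*\<^sub>R) \<rho> ` B) z) \<bullet> \<gamma> i \<ge> 0"
proof -
  let ?C = "(*\<^sub>R) \<rho> ` B"
  define n where "n = z - closest_point ?C z"
  have C: "closed ?C" "convex ?C" "?C \<noteq> {}"
    using B \<rho> by (auto intro: closed_scaling convex_scaling)
  obtain p where p: "p \<in> B" "closest_point ?C z = \<rho> *\<^sub>R p"
    using closest_point_in_set[OF C(1,3), of z] by auto
  have coord: "\<bar>z $ i - \<rho> * p $ i\<bar> \<le> \<rho>"
    using component_le_norm_cart[of n i] near by (simp add: n_def p)
  have *: "(z $ i \<le> 0 \<longrightarrow> n \<bullet> \<gamma> i \<le> 0) \<and> (z $ i \<ge> 0 \<longrightarrow> n \<bullet> \<gamma> i \<ge> 0)"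
  proof (cases "n = 0")
    case False
    have "n \<bullet> (x - p) \<le> 0" if "x \<in> B" for x
    proof -
      have "n \<bullet> (\<rho> *\<^sub>R x - closest_point ?C z) \<le> 0"
        unfolding n_def using that by (intro closest_point_dot[OF C(2,1)]) auto
      then have "\<rho> * (n \<bullet> (x - p)) \<le> 0" by (simp add: p inner_diff algebra_simps)
      then show ?thesis using \<rho> by (simp add: mult_le_0_iff)
    qed
    with False have on: "outward_normal B p n" by (simp add: outward_normal_def)
    with p have "p \<in> frontier B" by (intro outward_normal_imp_frontier)
    with on B(4) have "p $ i \<ge> -1 \<longrightarrow> n \<bullet> \<gamma> i \<ge> 0" "p $ i \<le> 1 \<longrightarrow> n \<bullet> \<gamma> i \<le> 0"
      by (auto simp: oblique_normals_def inner_axis inner_commute)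
    moreover have "p $ i \<le> 1" if "z $ i \<le> 0"
    proof -
      have "\<rho> * p $ i \<le> \<rho> * 1" using coord that by linarith
      then show ?thesis using \<rho> mult_le_cancel_left_pos by blast
    qed
    moreover have "p $ i \<ge> -1" if "z $ i \<ge> 0"
    proof -
      have "\<rho> * (-1) \<le> \<rho> * p $ i" using coord that by linarith
      then show ?thesis using \<rho> mult_le_cancel_left_pos by blast
    qed
    ultimately show ?thesis by blast
  qed simp
  show "z $ i \<le> 0 \<Longrightarrow> (z - closest_point ?C z) \<bullet> \<gamma> i \<le> 0"
    and "z $ i \<ge> 0 \<Longrightarrow> (z - closest_point ?C z) \<bullet> \<gamma> i \<ge> 0"
    using * by (auto simp: n_def)
qed

section \<open>Separated test functions and the viscosity inequalities\<close>

lemma closed_orthant: "closed orthant"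
  unfolding orthant_def by (intro closed_Collect_all closed_Collect_le continuous_intros)

lemma bounded_lipschitz_bounds:
  assumes "bounded_lipschitz w"
  shows "\<exists>L M. L \<ge> 0 \<and> (\<forall>t\<in>{0..1}. \<forall>x\<in>orthant. \<bar>w (t, x)\<bar> \<le> M) \<and>
    (\<forall>t\<in>{0..1}. \<forall>x\<in>orthant. \<forall>s\<in>{0..1}. \<forall>y\<in>orthant.
       \<bar>w (t, x) - w (s, y)\<bar> \<le> L * (\<bar>t - s\<bar> + norm (x - y)))"
proof -
  obtain L where L: "L-lipschitz_on ({0..1} \<times> orthant) w"
    using assms by (auto simp: bounded_lipschitz_def)
  obtain M where M: "\<forall>r \<in> w ` ({0..1} \<times> orthant). norm r \<le> M"
    using assms unfolding bounded_lipschitz_def bounded_iff by blast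
  have "\<bar>w (t, x) - w (s, y)\<bar> \<le> L * (\<bar>t - s\<bar> + norm (x - y))"
    if "t \<in> {0..1}" "x \<in> orthant" "s \<in> {0..1}" "y \<in> orthant" for t x s y
  proof -
    have "\<bar>w (t, x) - w (s, y)\<bar> \<le> L * dist (t, x) (s, y)"
      using lipschitz_onD[OF L, of "(t, x)" "(s, y)"] that by (simp add: dist_real_def)
    also have "dist (t, x) (s, y) \<le> \<bar>t - s\<bar> + norm (x - y)"
      using norm_Pair_le[of "t - s" "x - y"] by (simp add: dist_norm)
    finally show ?thesis using lipschitz_on_nonneg[OF L] by (simp add: mult_left_mono)
  qed
  moreover have "\<bar>w (t, x)\<bar> \<le> M" if "t \<in> {0..1}" "x \<in> orthant" for t x
    using M that by force
  ultimately show ?thesis using lipschitz_on_nonneg[OF L] by blast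
qed

lemma local_max_onI:
  assumes "p \<in> S" "open U" "p \<in> U" "\<And>q. q \<in> S \<Longrightarrow> q \<in> U \<Longrightarrow> \<phi> q \<le> \<phi> p"
  shows "local_max_on S \<phi> p"
  using assms unfolding local_max_on_def open_dist by blast

lemma local_min_onI:
  assumes "p \<in> S" "open U" "p \<in> U" "\<And>q. q \<in> S \<Longrightarrow> q \<in> U \<Longrightarrow> \<phi> p \<le> \<phi> q"
  shows "local_min_on S \<phi> p"
  using assms unfolding local_min_on_def open_dist by blast

lemma test_function_separated:
  fixes \<beta> :: "real^'d \<Rightarrow> real"
  assumes \<alpha>: "\<And>t. t \<in> {0<..<1} \<Longrightarrow> (\<alpha> has_real_derivative \<alpha>' t) (at t)"
    and \<alpha>': "continuous_on {0<..<1} \<alpha>'"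
    and \<beta>: "\<And>x. (\<beta> has_derivative (\<lambda>k. G x \<bullet> k)) (at x)"
    and G: "continuous_on orthant G"
  shows "test_function (\<lambda>(t, x). \<alpha> t + \<beta> x) (\<lambda>(t, x). \<alpha>' t) (\<lambda>(t, x). G x)"
  unfolding test_function_def
proof (intro conjI ballI)
  let ?S = "{0<..<1::real} \<times> (orthant :: (real^'d) set)"
  show "continuous_on ?S (\<lambda>(t, x). \<alpha>' t)"
    unfolding split_beta by (intro continuous_on_compose2[OF \<alpha>'] continuous_intros) auto
  show "continuous_on ?S (\<lambda>(t, x). G x)"
    unfolding split_beta by (intro continuous_on_compose2[OF G] continuous_intros) auto
  fix q assume q: "q \<in> ?S"
  have "((\<lambda>p. \<alpha> (fst p)) has_derivative (\<lambda>p. \<alpha>' (fst q) * fst p)) (at q within ?S)"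
    using q by (intro has_derivative_compose[OF _ \<alpha>[unfolded has_field_derivative_def]] derivative_eq_intros) auto
  moreover have "((\<lambda>p. \<beta> (snd p)) has_derivative (\<lambda>p. G (snd q) \<bullet> snd p)) (at q within ?S)"
    by (intro has_derivative_compose[OF _ \<beta>] derivative_eq_intros) auto
  ultimately have "((\<lambda>p. \<alpha> (fst p) + \<beta> (snd p)) has_derivative
      (\<lambda>p. \<alpha>' (fst q) * fst p + G (snd q) \<bullet> snd p)) (at q within ?S)"
    by (rule has_derivative_add)
  then show "((\<lambda>(t, x). \<alpha> t + \<beta> x) has_derivative
      (\<lambda>(h, k). (case q of (t, x) \<Rightarrow> \<alpha>' t) * h + (case q of (t, x) \<Rightarrow> G x) \<bullet> k)) (at q within ?S)"
    by (simp add: case_prod_unfold)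
qed

text \<open>If the test function strictly decreases along every active reflection direction, the boundary
  alternative of the subsolution condition is excluded and the differential inequality itself must
  hold, also at boundary points.\<close>

lemma viscosity_subsolution_inequality:
  assumes u: "viscosity_subsolution H f g \<gamma> u" and \<theta>: "test_function \<theta> \<theta>t D\<theta>"
    and s: "s \<in> {0<..<1}" and y: "y \<in> orthant" "y \<noteq> 0"
    and max: "local_max_on ({0<..<1} \<times> orthant) (\<lambda>q. u q - \<theta> q) (s, y)"
    and refl: "\<And>i. y $ i = 0 \<Longrightarrow> D\<theta> (s, y) \<bullet> \<gamma> i \<le> - \<delta>" and \<delta>: "\<delta> > 0"
  shows "u (s, y) \<le> g (s, y)" and "- \<theta>t (s, y) \<le> H (D\<theta> (s, y))"
proof -
  have main: "max (min (ereal (- \<theta>t (s, y) - H (D\<theta> (s, y))))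
                 (INF i\<in>zero_coords y. ereal (- (D\<theta> (s, y) \<bullet> \<gamma> i))))
            (ereal (u (s, y) - g (s, y))) \<le> 0"
    using u \<theta> s y max unfolding viscosity_subsolution_def by blast
  then show "u (s, y) \<le> g (s, y)" by simp
  have "ereal \<delta> \<le> (INF i\<in>zero_coords y. ereal (- (D\<theta> (s, y) \<bullet> \<gamma> i)))"
    using refl by (intro INF_greatest) (force simp: zero_coords_def)
  with \<delta> have "0 < (INF i\<in>zero_coords y. ereal (- (D\<theta> (s, y) \<bullet> \<gamma> i)))"
    by (meson ereal_less(2) less_le_trans)
  with main have "ereal (- \<theta>t (s, y) - H (D\<theta> (s, y))) \<le> 0"
    by (auto simp: min_le_iff_disj)
  then show "- \<theta>t (s, y) \<le> H (D\<theta> (s, y))" by simp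
qed

lemma viscosity_supersolution_inequality:
  assumes v: "viscosity_supersolution H f g \<gamma> v" and \<theta>: "test_function \<theta> \<theta>t D\<theta>"
    and s: "s \<in> {0<..<1}" and y: "y \<in> orthant" "y \<noteq> 0"
    and min: "local_min_on ({0<..<1} \<times> orthant) (\<lambda>q. v q - \<theta> q) (s, y)"
    and refl: "\<And>i. y $ i = 0 \<Longrightarrow> \<delta> \<le> D\<theta> (s, y) \<bullet> \<gamma> i" and \<delta>: "\<delta> > 0"
  shows "g (s, y) \<le> v (s, y) \<or> H (D\<theta> (s, y)) \<le> - \<theta>t (s, y)"
proof -
  have main: "max (max (ereal (- \<theta>t (s, y) - H (D\<theta> (s, y))))
                 (SUP i\<in>zero_coords y. ereal (- (D\<theta> (s, y) \<bullet> \<gamma> i))))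
            (ereal (v (s, y) - g (s, y))) \<ge> 0"
    using v \<theta> s y min unfolding viscosity_supersolution_def by blast
  have "(SUP i\<in>zero_coords y. ereal (- (D\<theta> (s, y) \<bullet> \<gamma> i))) \<le> ereal (- \<delta>)"
    using refl by (intro SUP_least) (force simp: zero_coords_def)
  with \<delta> have "(SUP i\<in>zero_coords y. ereal (- (D\<theta> (s, y) \<bullet> \<gamma> i))) < 0"
    by (metis ereal_less(1) le_less_trans neg_less_0_iff_less)
  with main show ?thesis by (auto simp: le_max_iff_disj)
qed

section \<open>Comparison by doubling of variables\<close>

text \<open>The quantitative core of the doubling argument. The penalty vanishes on a set of size \<open>\<rho> b\<close> and
  has strength \<open>1 / (c \<rho>)\<close>, so both sides scale in the same way in \<open>\<rho>\<close>. A small \<open>c\<close>, chosen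
  independently of \<open>\<rho>\<close>, then keeps the distance to \<open>\<rho> B\<close> below \<open>\<rho>\<close> at the maximum, as required
  by \<open>oblique_normals_gradient\<close>, so that the gradient of the penalty is at most \<open>2 / c\<close> there.\<close>

lemma penalty_forces_proximity:
  fixes a d :: real
  assumes "a \<ge> 0" "d \<ge> 0" "b \<ge> 0" "\<rho> > 0" "c > 0" "K \<ge> 0" and small: "c * K * (2 + b) < 1"
    and le: "(a\<^sup>2 + d\<^sup>2) / (c * \<rho>) \<le> K * (a + d + \<rho> * b)"
  shows "a < \<rho>" and "d < \<rho>"
proof -
  have "max a d < \<rho>"
  proof (rule ccontr)
    define m where "m = max a d"
    assume "\<not> max a d < \<rho>"
    then have m: "m \<ge> \<rho>" "m > 0" using assms by (auto simp: m_def)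
    have "m\<^sup>2 \<le> a\<^sup>2 + d\<^sup>2" by (auto simp: m_def max_def)
    also have "\<dots> \<le> c * \<rho> * (K * (a + d + \<rho> * b))"
      using le assms by (simp add: divide_le_eq mult_ac)
    also have "\<dots> \<le> c * m * (K * (m + m + m * b))"
      using assms m by (intro mult_mono add_mono) (auto simp: m_def)
    also have "\<dots> = (c * K * (2 + b)) * m\<^sup>2" by (simp add: algebra_simps power2_eq_square)
    also have "\<dots> < 1 * m\<^sup>2" using small m by (intro mult_strict_right_mono) auto
    finally show False by simp
  qed
  then show "a < \<rho>" "d < \<rho>" by auto
qed

text \<open>Doubling of variables. All smallness parameters are chosen in such an order that the
  momentum bound \<open>2 / c\<close> is known before the perturbation parameters \<open>R\<close>, \<open>\<delta>\<close> and \<open>\<rho>\<close>: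
  then uniform continuity of \<open>H\<close> on a fixed ball makes the difference of the Hamiltonians at the
  two points smaller than the gain \<open>\<eta>\<close> from the time penalty. Restricting to positive times keeps
  the penalty \<open>\<eta> / t\<close> finite at the point of comparison.\<close>

lemma comparison_positive_time:
  fixes H :: "real^'d \<Rightarrow> real" and u v g :: "real \<times> (real^'d) \<Rightarrow> real"
  assumes H: "continuous_on UNIV H" and g: "continuous_on ({0..1} \<times> orthant) g"
    and B: "compact B" "convex B" "0 \<in> interior B" "oblique_normals \<gamma> B"
    and q: "\<And>i. q \<bullet> \<gamma> i = -1"
    and u: "viscosity_subsolution H f g \<gamma> u" and v: "viscosity_supersolution H f g \<gamma> v"
    and t0: "0 < t0" "t0 \<le> 1" and x0: "x0 \<in> orthant"
  shows "u (t0, x0) \<le> v (t0, x0)"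
proof (rule ccontr)
  assume "\<not> u (t0, x0) \<le> v (t0, x0)"
  define \<sigma> where "\<sigma> = u (t0, x0) - v (t0, x0)"
  have \<sigma>: "\<sigma> > 0" using \<open>\<not> _\<close> by (simp add: \<sigma>_def)

  have "bounded_lipschitz u" "bounded_lipschitz v"
    using u v by (simp_all add: viscosity_subsolution_def viscosity_supersolution_def)
  from bounded_lipschitz_bounds[OF \<open>bounded_lipschitz u\<close>] obtain Lu Mu where Lu0: "Lu \<ge> 0"
    and Mu: "\<forall>t\<in>{0..1}. \<forall>x\<in>orthant. \<bar>u (t, x)\<bar> \<le> Mu"
    and Lu: "\<forall>t\<in>{0..1}. \<forall>x\<in>orthant. \<forall>s\<in>{0..1}. \<forall>y\<in>orthant.
           \<bar>u (t, x) - u (s, y)\<bar> \<le> Lu * (\<bar>t - s\<bar> + norm (x - y))"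
    by auto
  from bounded_lipschitz_bounds[OF \<open>bounded_lipschitz v\<close>] obtain Lv Mv where Lv0: "Lv \<ge> 0"
    and Mv: "\<forall>t\<in>{0..1}. \<forall>x\<in>orthant. \<bar>v (t, x)\<bar> \<le> Mv"
    and Lv: "\<forall>t\<in>{0..1}. \<forall>x\<in>orthant. \<forall>s\<in>{0..1}. \<forall>y\<in>orthant.
           \<bar>v (t, x) - v (s, y)\<bar> \<le> Lv * (\<bar>t - s\<bar> + norm (x - y))"
    by auto
  define L where "L = Lu + Lv"
  define A where "A = Mu + Mv + 1"
  have L: "L \<ge> 0" using Lu0 Lv0 by (simp add: L_def)
  have lip: "\<bar>u (t, x) - u (s, y)\<bar> \<le> L * (\<bar>t - s\<bar> + norm (x - y))"
    "\<bar>v (t, x) - v (s, y)\<bar> \<le> L * (\<bar>t - s\<bar> + norm (x - y))"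
    if "t \<in> {0..1}" "x \<in> orthant" "s \<in> {0..1}" "y \<in> orthant" for t x s y
  proof -
    have "Lu * (\<bar>t - s\<bar> + norm (x - y)) \<le> L * (\<bar>t - s\<bar> + norm (x - y))"
      "Lv * (\<bar>t - s\<bar> + norm (x - y)) \<le> L * (\<bar>t - s\<bar> + norm (x - y))"
      using Lu0 Lv0 by (auto simp: L_def intro!: mult_right_mono)
    with Lu Lv that show "\<bar>u (t, x) - u (s, y)\<bar> \<le> L * (\<bar>t - s\<bar> + norm (x - y))"
      "\<bar>v (t, x) - v (s, y)\<bar> \<le> L * (\<bar>t - s\<bar> + norm (x - y))"
      by (meson order_trans)+
  qed
  have gap_le: "u (t, x) - v (s, y) \<le> A - 1"
    if "t \<in> {0..1}" "x \<in> orthant" "s \<in> {0..1}" "y \<in> orthant" for t x s y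
      proof -
    have "\<bar>u (t, x)\<bar> \<le> Mu" "\<bar>v (s, y)\<bar> \<le> Mv" using Mu Mv that by auto
    then show ?thesis by (simp add: A_def)
  qed
  have \<sigma>A: "\<sigma> \<le> A - 1" using gap_le[of t0 x0 t0 x0] t0 x0 by (simp add: \<sigma>_def)
  have cont: "continuous_on ({0..1} \<times> orthant) u" "continuous_on ({0..1} \<times> orthant) v"
    using \<open>bounded_lipschitz u\<close> \<open>bounded_lipschitz v\<close> unfolding bounded_lipschitz_def
    by (auto intro: lipschitz_on_continuous_on)
  have bdry: "u (t, x) \<le> v (t, x)" if "t \<in> {0..1}" "x \<in> orthant" "t = 1 \<or> x = 0" for t x
  proof (cases "x = 0")
    case True
    then show ?thesis using u v that
      by (simp add: viscosity_subsolution_def viscosity_supersolution_def)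
  next
    case False
    with that have "u (t, x) \<le> f x" "f x \<le> v (t, x)"
      using u v by (auto simp: viscosity_subsolution_def viscosity_supersolution_def)
    then show ?thesis by simp
  qed

  have "0 \<in> B" using B(3) interior_subset by auto
  then have clB: "closed B" "B \<noteq> {}" using B(1) by (auto intro: compact_imp_closed)
  obtain r where r: "r > 0" "ball 0 r \<subseteq> B" using B(3) by (auto simp: mem_interior)
  obtain b where b: "b > 0" "\<And>z. z \<in> B \<Longrightarrow> norm z \<le> b"
    using compact_imp_bounded[OF B(1)] by (auto simp: bounded_pos)
  have scaled: "closed ((*\<^sub>R) \<nu> ` B)" "convex ((*\<^sub>R) \<nu> ` B)" "(*\<^sub>R) \<nu> ` B \<noteq> {}" for \<nu>
    using clB B(2) by (auto intro: closed_scaling convex_scaling)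
  have norm_le: "norm z \<le> norm (z - closest_point ((*\<^sub>R) \<nu> ` B) z) + \<nu> * b" if "\<nu> > 0" for z \<nu>
    using norm_le_closest_point_scaled[OF clB b(2) that] .

  \<comment> \<open>The combined Lipschitz constant in the proximity estimate; \<open>norm q\<close> accounts for the linear
      perturbation, whose coefficient \<open>\<delta>\<close> is at most \<open>1\<close>.\<close>
  define K where "K = L + norm q"
  have K: "K \<ge> 0" using L by (simp add: K_def)
  define c where "c = 1 / ((K + 1) * (2 + b))"
  have c: "c > 0" "c * K * (2 + b) < 1" using K b by (auto simp: c_def)
  \<comment> \<open>With this size the time penalty costs only \<open>\<sigma> / 8\<close> at the point of comparison.\<close>
  define \<eta> where "\<eta> = \<sigma> * t0 / 8"
  have \<eta>: "\<eta> > 0" "\<eta> / t0 = \<sigma> / 8" using \<sigma> t0 by (auto simp: \<eta>_def)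
  have "uniformly_continuous_on (cball 0 (2 / c + 1)) H"
    using continuous_on_subset[OF H] by (intro compact_uniformly_continuous) auto
  then obtain \<kappa>0 where \<kappa>0: "\<kappa>0 > 0" "\<And>p p'. p \<in> cball 0 (2 / c + 1) \<Longrightarrow> p' \<in> cball 0 (2 / c + 1) \<Longrightarrow>
      dist p' p < \<kappa>0 \<Longrightarrow> dist (H p') (H p) < \<eta>"
    using \<eta>(1) unfolding uniformly_continuous_on_def by metis
  define \<kappa> where "\<kappa> = min \<kappa>0 1"
  have \<kappa>: "\<kappa> > 0" "\<kappa> \<le> \<kappa>0" "\<kappa> \<le> 1" using \<kappa>0(1) by (auto simp: \<kappa>_def)
  \<comment> \<open>The radius makes \<open>x0\<close> a point of \<open>R B\<close>, where the growth penalty vanishes, and makes the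
      gradient of that penalty, at most \<open>2 A / R\<close>, small compared with \<open>\<kappa>\<close>.\<close>
  define R where "R = norm x0 / r + 8 * A / \<kappa> + 1"
  have A: "A > 1" using \<sigma> \<sigma>A by simp
  have R: "R > 0" "R * \<kappa> > 8 * A" "R * r > norm x0"
  proof -
    have *: "norm x0 / r \<ge> 0" "8 * A / \<kappa> > 0" using r \<kappa> A by auto
    then show "R > 0" unfolding R_def by linarith
    have "8 * A / \<kappa> < R" "norm x0 / r < R" using * unfolding R_def by linarith+
    then show "R * \<kappa> > 8 * A" "R * r > norm x0" using r \<kappa> by (simp_all add: divide_less_eq)
  qed
  let ?RB = "(*\<^sub>R) R ` B"
  have x0RB: "x0 \<in> ?RB"
  proof
    show "x0 = R *\<^sub>R (x0 /\<^sub>R R)" using R(1) by simp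
    show "x0 /\<^sub>R R \<in> B" using R r by (intro subsetD[OF r(2)]) (simp add: field_simps)
  qed
  \<comment> \<open>Bounds for the first and the second space variable. The surplus in \<open>Y\<close> leaves the second
      variable free to move near the maximum.\<close>
  define X where "X = R * (1 + b)"
  define Y where "Y = X + 2 + b"
  have XY: "X > 0" "Y > 0"
  proof -
    show "X > 0" using R b by (simp add: X_def)
    then show "Y > 0" using b by (simp add: Y_def)
  qed
  define m where "m = min (min (\<sigma> / 8) (\<kappa> / 8)) 1"
  have m: "m > 0" "m \<le> \<sigma> / 8" "m \<le> \<kappa> / 8" "m \<le> 1" using \<sigma> \<kappa> by (auto simp: m_def)
  define \<delta> where "\<delta> = m / ((norm q + 1) * (X + Y + 1))"
  have nq: "norm q + 1 > 0" by (simp add: add_nonneg_pos)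
  have \<delta>: "\<delta> > 0" using m XY nq by (simp add: \<delta>_def)
  have \<delta>m: "\<delta> * ((norm q + 1) * (X + Y + 1)) = m"
    using XY nq by (simp add: \<delta>_def)
  have \<delta>1: "\<delta> \<le> 1" and \<delta>q: "\<delta> * norm q \<le> \<kappa> / 8" and \<delta>XY: "\<delta> * (norm q * (X + Y)) \<le> \<sigma> / 8"
  proof -
    have "1 * 1 \<le> (norm q + 1) * (X + Y + 1)" "norm q * 1 \<le> (norm q + 1) * (X + Y + 1)"
      "norm q * (X + Y) \<le> (norm q + 1) * (X + Y + 1)"
      using XY by (intro mult_mono; simp)+
    from this[THEN mult_left_mono, of \<delta>] \<delta> \<delta>m m
    show "\<delta> \<le> 1" "\<delta> * norm q \<le> \<kappa> / 8" "\<delta> * (norm q * (X + Y)) \<le> \<sigma> / 8" by auto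
  qed
  \<comment> \<open>At this cut-off time the penalty \<open>\<eta> / t\<close> exceeds any possible gain.\<close>
  define \<tau> where "\<tau> = min t0 (\<eta> / A)"
  have \<tau>: "\<tau> > 0" "\<tau> \<le> t0" "\<eta> / \<tau> \<ge> A"
  proof -
    show \<tau>0: "\<tau> > 0" "\<tau> \<le> t0" using t0 \<eta> A by (auto simp: \<tau>_def)
    have "\<tau> \<le> \<eta> / A" by (simp add: \<tau>_def)
    then show "\<eta> / \<tau> \<ge> A" using \<tau>0 A by (simp add: field_simps)
  qed
  have "compact ({0..1::real} \<times> (orthant \<inter> cball (0::real^'d) Y))"
    using closed_orthant by (intro compact_Times closed_Int_compact) auto
  then have "uniformly_continuous_on ({0..1} \<times> (orthant \<inter> cball 0 Y)) g"
    by (intro compact_uniformly_continuous continuous_on_subset[OF g]) auto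
  then obtain \<mu> where \<mu>: "\<mu> > 0" "\<And>p p'. p \<in> {0..1} \<times> (orthant \<inter> cball 0 Y) \<Longrightarrow>
      p' \<in> {0..1} \<times> (orthant \<inter> cball 0 Y) \<Longrightarrow> dist p' p < \<mu> \<Longrightarrow> dist (g p') (g p) < \<sigma> / 2"
    using \<sigma> unfolding uniformly_continuous_on_def by (metis half_gt_zero)
  define \<rho> where "\<rho> = min (min 1 \<tau>) (min (\<mu> / (2 + b)) (\<sigma> / (2 * (L + 1) * (2 + b))))"
  have \<rho>: "\<rho> > 0" "\<rho> \<le> 1" "\<rho> \<le> \<tau>" "\<rho> * (2 + b) \<le> \<mu>" "L * (\<rho> * (2 + b)) \<le> \<sigma> / 2"
  proof -
    show \<rho>0: "\<rho> > 0" "\<rho> \<le> 1" "\<rho> \<le> \<tau>" using \<tau> \<mu> \<sigma> L b by (auto simp: \<rho>_def)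
    have "\<rho> \<le> \<mu> / (2 + b)" "\<rho> \<le> \<sigma> / (2 * (L + 1) * (2 + b))" by (auto simp: \<rho>_def)
    then show "\<rho> * (2 + b) \<le> \<mu>" and *: "L * (\<rho> * (2 + b)) \<le> \<sigma> / 2"
    proof -
      show "\<rho> * (2 + b) \<le> \<mu>" using \<open>\<rho> \<le> \<mu> / (2 + b)\<close> b by (simp add: le_divide_eq)
      have "\<rho> * (2 * (L + 1) * (2 + b)) \<le> \<sigma>"
        using \<open>\<rho> \<le> \<sigma> / _\<close> b L by (subst (asm) le_divide_eq) auto
      moreover have "L * (\<rho> * (2 + b)) \<le> (L + 1) * (\<rho> * (2 + b))"
        using \<rho>0 b by (intro mult_right_mono) auto
      moreover have "\<rho> * (2 * (L + 1) * (2 + b)) = 2 * ((L + 1) * (\<rho> * (2 + b)))"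
        by (simp add: algebra_simps)
      ultimately show "L * (\<rho> * (2 + b)) \<le> \<sigma> / 2" by linarith
    qed
  qed
  let ?\<rho>B = "(*\<^sub>R) \<rho> ` B"

  \<comment> \<open>The squared distance to \<open>\<rho> B\<close> glues the space variables and has gradients with the right
      sign on the faces. The squared distance to \<open>R B\<close> localizes, with compatible gradient and total
      height \<open>A\<close> at distance \<open>R\<close>. The two linear terms make both boundary inequalities strict.\<close>
  define \<Phi> where "\<Phi> t x s y = u (t, x) - v (s, y)
      - ((t - s)\<^sup>2 + sq_dist_to ?\<rho>B (x - y)) / (c * \<rho>)
      - A / R\<^sup>2 * sq_dist_to ?RB x - \<delta> * (q \<bullet> x) - \<delta> * (q \<bullet> y) - \<eta> / t" for t x s y
  \<comment> \<open>Only in this region is the gradient of the growth penalty known to be compatible.\<close>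
  define near where "near = {x \<in> orthant. norm (x - closest_point ?RB x) \<le> R}"
  have near_norm: "norm x \<le> X" if "x \<in> near" for x
    using norm_le[OF R(1), of x] that by (simp add: near_def X_def algebra_simps)
  have near_orthant: "x \<in> orthant" if "x \<in> near" for x using that by (simp add: near_def)
  have "compact near"
  proof -
    have "closed near"
      unfolding near_def using closed_orthant
      by (intro closed_Collect_conj closed_Collect_le continuous_intros continuous_on_minus_closest_point scaled) auto
    then show ?thesis using near_norm by (auto simp: compact_eq_bounded_closed bounded_iff)
  qed
  define D where "D = ({\<tau>..1} \<times> near) \<times> ({0..1::real} \<times> (orthant \<inter> cball (0::real^'d) Y))"
  have "compact D"
    unfolding D_def using closed_orthant \<open>compact near\<close> by (intro compact_Times closed_Int_compact) auto
  moreover have "((t0, x0), (t0, x0)) \<in> D"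
    using t0 x0 \<tau> x0RB norm_le[OF R(1), of x0] R b
    by (auto simp: D_def near_def closest_point_self Y_def X_def algebra_simps)
  moreover have "continuous_on D (\<lambda>((t, x), (s, y)). \<Phi> t x s y)"
    unfolding \<Phi>_def case_prod_unfold
    using c \<rho> \<tau>
    by (intro continuous_intros scaled continuous_on_compose2[OF cont(1)] continuous_on_compose2[OF cont(2)])
      (auto simp: D_def near_def)
  ultimately obtain z where z: "z \<in> D"
    "\<And>z'. z' \<in> D \<Longrightarrow> (\<lambda>((t, x), (s, y)). \<Phi> t x s y) z' \<le> (\<lambda>((t, x), (s, y)). \<Phi> t x s y) z"
    using continuous_attains_sup[of D "\<lambda>((t, x), (s, y)). \<Phi> t x s y"] by blast
  obtain t x s y where "z = ((t, x), (s, y))" by (metis prod.exhaust)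
  with z have "((t, x), (s, y)) \<in> D"
    and "\<And>t' x' s' y'. ((t', x'), (s', y')) \<in> D \<Longrightarrow> \<Phi> t' x' s' y' \<le> \<Phi> t x s y"
    by fastforce+
  then have t: "\<tau> \<le> t" "t \<le> 1" and x: "x \<in> near" and s: "0 \<le> s" "s \<le> 1"
    and y: "y \<in> orthant" "norm y \<le> Y"
    and max: "\<And>t' x' s' y'. \<tau> \<le> t' \<Longrightarrow> t' \<le> 1 \<Longrightarrow> x' \<in> near \<Longrightarrow> 0 \<le> s' \<Longrightarrow> s' \<le> 1 \<Longrightarrow>
        y' \<in> orthant \<Longrightarrow> norm y' \<le> Y \<Longrightarrow> \<Phi> t' x' s' y' \<le> \<Phi> t x s y"
    by (auto simp: D_def)
  have xo: "x \<in> orthant" and xX: "norm x \<le> X" using x near_orthant near_norm by auto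
  have t_pos: "t > 0" using t \<tau> by simp
  have ivl: "t \<in> {0..1}" "s \<in> {0..1}" using t s t_pos by auto
  define pen where "pen = ((t - s)\<^sup>2 + sq_dist_to ?\<rho>B (x - y)) / (c * \<rho>)"
  have pen0: "pen \<ge> 0" unfolding pen_def using c \<rho> by (simp add: sq_dist_to_def)
  define P where "P = A / R\<^sup>2 * sq_dist_to ?RB x"
  have P0: "P \<ge> 0" unfolding P_def using A by (simp add: sq_dist_to_def)
  have \<Phi>_eq: "\<Phi> t x s y = u (t, x) - v (s, y) - pen - P - \<delta> * (q \<bullet> x) - \<delta> * (q \<bullet> y) - \<eta> / t"
    by (simp add: \<Phi>_def pen_def P_def)
  have lin: "\<delta> * \<bar>q \<bullet> z\<bar> + \<delta> * \<bar>q \<bullet> w\<bar> \<le> \<sigma> / 8" if "norm z \<le> X" "norm w \<le> Y" for z w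
  proof -
    have "\<bar>q \<bullet> z\<bar> \<le> norm q * X" "\<bar>q \<bullet> w\<bar> \<le> norm q * Y"
      using that by (meson Cauchy_Schwarz_ineq2 mult_left_mono norm_ge_zero order_trans)+
    then have "\<bar>q \<bullet> z\<bar> + \<bar>q \<bullet> w\<bar> \<le> norm q * (X + Y)" by (simp add: algebra_simps)
    then have "\<delta> * (\<bar>q \<bullet> z\<bar> + \<bar>q \<bullet> w\<bar>) \<le> \<delta> * (norm q * (X + Y))"
      using \<delta> by (intro mult_left_mono) auto
    then show ?thesis using \<delta>XY by (simp add: algebra_simps)
  qed
  have lin': "- (\<sigma> / 8) \<le> \<delta> * (q \<bullet> x) + \<delta> * (q \<bullet> y)"
  proof -
    have "- (\<delta> * \<bar>a\<bar>) \<le> \<delta> * a" for a :: real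
      using \<delta> mult_left_mono[of "- \<bar>a\<bar>" a \<delta>] by simp
    from this[of "q \<bullet> x"] this[of "q \<bullet> y"] show ?thesis using lin[OF xX y(2)] by linarith
  qed

  have sq0: "sq_dist_to ?\<rho>B 0 = 0"
    using \<open>0 \<in> B\<close> by (subst sq_dist_to_def, subst closest_point_self) force+
  \<comment> \<open>The undoubled point \<open>(t0, x0, t0, x0)\<close> bounds the maximum from below.\<close>
  have \<Phi>_base: "\<Phi> t x s y \<ge> 3 * \<sigma> / 4"
  proof -
    have x0n: "x0 \<in> near" using x0 x0RB R by (simp add: near_def closest_point_self)
    have x0X: "norm x0 \<le> X" "norm x0 \<le> Y" using near_norm[OF x0n] b by (auto simp: Y_def)
    have "sq_dist_to ?RB x0 = 0" by (simp add: sq_dist_to_def closest_point_self[OF x0RB])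
    then have "\<Phi> t0 x0 t0 x0 = \<sigma> - \<delta> * (q \<bullet> x0) - \<delta> * (q \<bullet> x0) - \<sigma> / 8"
      using \<eta> by (simp add: \<Phi>_def \<sigma>_def sq0)
    moreover have "\<delta> * (q \<bullet> x0) \<le> \<delta> * \<bar>q \<bullet> x0\<bar>" using \<delta> by simp
    ultimately have "\<Phi> t0 x0 t0 x0 \<ge> 3 * \<sigma> / 4" using lin[OF x0X] by linarith
    also have "\<Phi> t0 x0 t0 x0 \<le> \<Phi> t x s y"
      using t0 \<tau> x0n x0X x0 by (intro max) auto
    finally show ?thesis .
  qed
  have gap: "u (t, x) - v (s, y) - P - \<eta> / t \<ge> 5 * \<sigma> / 8"
    using \<Phi>_base \<Phi>_eq lin' pen0 by linarith
  have \<eta>t: "\<eta> / t > 0" using \<eta> t_pos by simp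
  have gap': "u (t, x) - v (s, y) > \<sigma> / 2" using gap P0 \<eta>t \<sigma> by linarith

  \<comment> \<open>Moving the second point onto the first removes the gluing penalty, which is therefore
      controlled by the Lipschitz continuity of \<open>v\<close>.\<close>
  have "\<Phi> t x t x \<le> \<Phi> t x s y"
    using t x xo xX t_pos b by (intro max) (auto simp: Y_def)
  then have "pen \<le> v (t, x) - v (s, y) + \<delta> * (q \<bullet> (x - y))"
    by (simp add: \<Phi>_eq) (simp add: \<Phi>_def sq0 P_def inner_diff_right right_diff_distrib)
  also have "v (t, x) - v (s, y) \<le> L * (\<bar>t - s\<bar> + norm (x - y))"
    using lip(2)[OF ivl(1) xo ivl(2) y(1)] by linarith
  also have "\<delta> * (q \<bullet> (x - y)) \<le> 1 * (norm q * norm (x - y))"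
  proof -
    have "\<delta> * (q \<bullet> (x - y)) \<le> \<delta> * (norm q * norm (x - y))"
      using \<delta> norm_cauchy_schwarz[of q "x - y"] by (intro mult_left_mono) auto
    also have "\<dots> \<le> 1 * (norm q * norm (x - y))" using \<delta>1 by (intro mult_right_mono) auto
    finally show ?thesis .
  qed
  finally have "pen \<le> L * (\<bar>t - s\<bar> + norm (x - y)) + norm q * norm (x - y)" by simp
  also have "\<dots> \<le> K * (\<bar>t - s\<bar> + norm (x - y))"
    by (simp add: K_def algebra_simps)
  also have "\<dots> \<le> K * (\<bar>t - s\<bar> + norm (x - y - closest_point ?\<rho>B (x - y)) + \<rho> * b)"
    using norm_le[OF \<rho>(1), of "x - y"] K by (intro mult_left_mono) auto
  finally have "pen \<le> \<dots>" .
  then have "(\<bar>t - s\<bar>\<^sup>2 + (norm (x - y - closest_point ?\<rho>B (x - y)))\<^sup>2) / (c * \<rho>) \<le>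
      K * (\<bar>t - s\<bar> + norm (x - y - closest_point ?\<rho>B (x - y)) + \<rho> * b)"
    by (simp add: pen_def sq_dist_to_def)
  from penalty_forces_proximity[OF _ _ _ _ _ _ c(2) this] c K b \<rho>
  have ts: "\<bar>t - s\<bar> < \<rho>" and d: "norm (x - y - closest_point ?\<rho>B (x - y)) < \<rho>" by auto
  have xy: "norm (x - y) < \<rho> * (1 + b)"
    using norm_le[OF \<rho>(1), of "x - y"] d by (simp add: algebra_simps)
  have dist_lt: "\<bar>t - s\<bar> + norm (x - y) < \<rho> * (2 + b)"
    using ts xy by (simp add: algebra_simps)
  have yY: "norm y < Y"
  proof -
    have "\<rho> * (1 + b) \<le> 1 * (1 + b)" using \<rho> b by (intro mult_right_mono) auto
    then show ?thesis using norm_triangle_sub[of y x] xX xy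
      by (simp add: Y_def norm_minus_commute)
  qed
  \<comment> \<open>The maximum avoids the artificial boundaries of the domain of maximization, so that it is a
      local maximum in \<open>(0,1) \<times> orthant\<close>.\<close>
  have t\<tau>: "t > \<tau>"
  proof (rule ccontr)
    assume "\<not> t > \<tau>"
    then have "\<eta> / t \<ge> A" using t \<tau> by simp
    then show False using gap gap_le[OF ivl(1) xo ivl(2) y(1)] P0 \<sigma> by linarith
  qed
  have xR: "norm (x - closest_point ?RB x) < R"
  proof (rule ccontr)
    assume "\<not> norm (x - closest_point ?RB x) < R"
    with x have "norm (x - closest_point ?RB x) = R" by (simp add: near_def)
    then have "P = A" using R by (simp add: P_def sq_dist_to_def)
    then show False using gap gap_le[OF ivl(1) xo ivl(2) y(1)] \<eta>t \<sigma> by linarith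
  qed
  have s0: "s > 0" using ts \<rho> t\<tau> by linarith
  \<comment> \<open>The initial gap survives at both points, which excludes terminal time and the origin.\<close>
  have close: "L * (\<bar>t - s\<bar> + norm (x - y)) \<le> \<sigma> / 2"
    using mult_left_mono[OF less_imp_le[OF dist_lt] L] \<rho>(5) by linarith
  have "u (t, x) > v (t, x)" "u (s, y) > v (s, y)"
    using lip[OF ivl(1) xo ivl(2) y(1)] close gap' by linarith+
  with bdry[OF ivl(1) xo] bdry[OF ivl(2) y(1)]
  have t1: "t \<noteq> 1" "x \<noteq> 0" "s \<noteq> 1" "y \<noteq> 0" by auto
  have t01: "t \<in> {0<..<1}" and s01: "s \<in> {0<..<1}" using t1 t s t_pos s0 by auto

  \<comment> \<open>The common part of the two gradients, compatible with reflection at both points because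
      \<open>x - y\<close> has \<open>i\<close>-th coordinate at most \<open>0\<close> if \<open>x $ i = 0\<close>, and at least \<open>0\<close> if
      \<open>y $ i = 0\<close>.\<close>
  define p where "p = (2 / (c * \<rho>)) *\<^sub>R (x - y - closest_point ?\<rho>B (x - y))"
  have cr: "2 / (c * \<rho>) > 0" using c \<rho> by simp
  have "norm p = 2 / (c * \<rho>) * norm (x - y - closest_point ?\<rho>B (x - y))"
    unfolding p_def norm_scaleR using cr by simp
  also have "\<dots> \<le> 2 / (c * \<rho>) * \<rho>"
    using d cr by (intro mult_left_mono) auto
  finally have norm_p: "norm p \<le> 2 / c" using \<rho> by simp
  have p_refl: "x $ i = 0 \<Longrightarrow> p \<bullet> \<gamma> i \<le> 0" "y $ i = 0 \<Longrightarrow> p \<bullet> \<gamma> i \<ge> 0" for i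
  proof -
    note og = oblique_normals_gradient[OF clB(1) B(2) clB(2) B(4) \<rho>(1) less_imp_le[OF d], of i]
    have eq: "p \<bullet> \<gamma> i = 2 / (c * \<rho>) * ((x - y - closest_point ?\<rho>B (x - y)) \<bullet> \<gamma> i)"
      unfolding p_def inner_scaleR_left ..
    show "p \<bullet> \<gamma> i \<le> 0" if "x $ i = 0"
      unfolding eq using og(1) that y(1) cr by (intro mult_nonneg_nonpos) (auto simp: orthant_def)
    show "p \<bullet> \<gamma> i \<ge> 0" if "y $ i = 0"
      unfolding eq using og(2) that xo cr by (intro mult_nonneg_nonneg) (auto simp: orthant_def)
  qed

  \<comment> \<open>The test function for \<open>u\<close>: all terms of \<open>- \<Phi>\<close> that depend on the first point, except
      \<open>u\<close> itself.\<close>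
  define \<alpha> where "\<alpha> t' = (t' - s)\<^sup>2 / (c * \<rho>) + \<eta> / t'" for t'
  define \<alpha>' where "\<alpha>' t' = 2 * (t' - s) / (c * \<rho>) - \<eta> / t'\<^sup>2" for t'
  define \<beta> where "\<beta> x' = sq_dist_to ?\<rho>B (x' - y) / (c * \<rho>) + A / R\<^sup>2 * sq_dist_to ?RB x' + \<delta> * (q \<bullet> x')" for x'
  define G where "G x' = (2 / (c * \<rho>)) *\<^sub>R (x' - y - closest_point ?\<rho>B (x' - y))
      + (2 * A / R\<^sup>2) *\<^sub>R (x' - closest_point ?RB x') + \<delta> *\<^sub>R q" for x'
  have u_test: "test_function (\<lambda>(t, x). \<alpha> t + \<beta> x) (\<lambda>(t, x). \<alpha>' t) (\<lambda>(t, x). G x)"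
  proof (rule test_function_separated)
    show "(\<alpha> has_real_derivative \<alpha>' t') (at t')" if "t' \<in> {0<..<1}" for t'
      unfolding \<alpha>_def \<alpha>'_def using that c \<rho>
      by (auto intro!: derivative_eq_intros simp: power2_eq_square)
    show "continuous_on {0<..<1} \<alpha>'"
      unfolding \<alpha>'_def using c \<rho> by (intro continuous_intros) auto
    show "continuous_on orthant G"
      unfolding G_def
      by (intro continuous_intros continuous_on_minus_closest_point scaled
          continuous_on_compose2[OF continuous_on_minus_closest_point[OF scaled]]) auto
    fix x'
    have "((\<lambda>x'. sq_dist_to ?\<rho>B (x' - y)) has_derivative
        (\<lambda>k. (2 *\<^sub>R (x' - y - closest_point ?\<rho>B (x' - y))) \<bullet> k)) (at x')"
      by (rule has_derivative_compose[OF _ has_derivative_sq_dist_to[OF scaled]])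
        (auto intro!: derivative_eq_intros)
    then have "((\<lambda>x'. 1 / (c * \<rho>) * sq_dist_to ?\<rho>B (x' - y) + A / R\<^sup>2 * sq_dist_to ?RB x' + \<delta> * (q \<bullet> x'))
        has_derivative
        (\<lambda>k. 1 / (c * \<rho>) * ((2 *\<^sub>R (x' - y - closest_point ?\<rho>B (x' - y))) \<bullet> k)
          + A / R\<^sup>2 * ((2 *\<^sub>R (x' - closest_point ?RB x')) \<bullet> k) + \<delta> * (q \<bullet> k))) (at x')"
      by (intro has_derivative_add has_derivative_mult_right has_derivative_sq_dist_to scaled
          bounded_linear_imp_has_derivative bounded_linear_inner_right)
    then show "(\<beta> has_derivative (\<lambda>k. G x' \<bullet> k)) (at x')"
      by (simp add: \<beta>_def[abs_def] G_def inner_add_left mult_ac)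
  qed
  have "open {x. norm (x - closest_point ?RB x) < R}"
    by (intro open_Collect_less continuous_intros continuous_on_minus_closest_point scaled)
  then have "open ({\<tau><..} \<times> {x. norm (x - closest_point ?RB x) < R})"
    by (intro open_Times) auto
  then have u_max: "local_max_on ({0<..<1} \<times> orthant) (\<lambda>z. u z - (\<lambda>(t, x). \<alpha> t + \<beta> x) z) (t, x)"
  proof (rule local_max_onI[rotated])
    fix z assume z: "z \<in> {0<..<1} \<times> orthant" "z \<in> {\<tau><..} \<times> {x. norm (x - closest_point ?RB x) < R}"
    obtain t' x' where z': "z = (t', x')" by (cases z)
    have "\<Phi> t' x' s y \<le> \<Phi> t x s y"
      using z s y by (intro max) (auto simp: z' near_def)
    then show "u z - (\<lambda>(t, x). \<alpha> t + \<beta> x) z \<le> u (t, x) - (\<lambda>(t, x). \<alpha> t + \<beta> x) (t, x)"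
      by (simp add: z' \<Phi>_def \<alpha>_def \<beta>_def add_divide_distrib)
  qed (use t01 xo xR t\<tau> in auto)
  have G_eq: "G x = p + (2 * A / R\<^sup>2) *\<^sub>R (x - closest_point ?RB x) + \<delta> *\<^sub>R q"
    by (simp add: G_def p_def)
  have u_refl: "G x \<bullet> \<gamma> i \<le> - \<delta>" if "x $ i = 0" for i
  proof -
    have "(x - closest_point ?RB x) \<bullet> \<gamma> i \<le> 0"
      using oblique_normals_gradient(1)[OF clB(1) B(2) clB(2) B(4) R(1) less_imp_le[OF xR], of i] that by simp
    then have "2 * A / R\<^sup>2 * ((x - closest_point ?RB x) \<bullet> \<gamma> i) \<le> 0"
      using A by (intro mult_nonneg_nonpos) auto
    then show ?thesis using p_refl(1)[OF that] q[of i] by (simp add: G_eq inner_add_left)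
  qed
  have u_le: "u (t, x) \<le> g (t, x)" and u_ineq: "- \<alpha>' t \<le> H (G x)"
    using viscosity_subsolution_inequality[OF u u_test t01 xo t1(2) u_max _ \<delta>] u_refl by auto

  \<comment> \<open>The test function for \<open>v\<close>: all terms of \<open>\<Phi>\<close> that depend on the second point, except
      \<open>v\<close> itself.\<close>
  define \<beta>2 where "\<beta>2 y' = - sq_dist_to ?\<rho>B (x - y') / (c * \<rho>) - \<delta> * (q \<bullet> y')" for y'
  define G2 where "G2 y' = (2 / (c * \<rho>)) *\<^sub>R (x - y' - closest_point ?\<rho>B (x - y')) - \<delta> *\<^sub>R q" for y'
  have v_test: "test_function (\<lambda>(s, y). - (t - s)\<^sup>2 / (c * \<rho>) + \<beta>2 y)
      (\<lambda>(s, y). 2 * (t - s) / (c * \<rho>)) (\<lambda>(s, y). G2 y)"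
  proof (rule test_function_separated)
    show "((\<lambda>s. - (t - s)\<^sup>2 / (c * \<rho>)) has_real_derivative 2 * (t - s') / (c * \<rho>)) (at s')"
      if "s' \<in> {0<..<1}" for s'
      using that c \<rho> by (auto intro!: derivative_eq_intros simp: field_simps)
    show "continuous_on {0<..<1} (\<lambda>s. 2 * (t - s) / (c * \<rho>))"
      using c \<rho> by (intro continuous_intros) auto
    show "continuous_on orthant G2"
      unfolding G2_def
      by (intro continuous_intros
          continuous_on_compose2[OF continuous_on_minus_closest_point[OF scaled]]) auto
    fix y'
    have "((\<lambda>y'. sq_dist_to ?\<rho>B (x - y')) has_derivative
        (\<lambda>k. (2 *\<^sub>R (x - y' - closest_point ?\<rho>B (x - y'))) \<bullet> (- k))) (at y')"
      by (rule has_derivative_compose[OF _ has_derivative_sq_dist_to[OF scaled]])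
        (auto intro!: derivative_eq_intros)
    then have "((\<lambda>y'. - 1 / (c * \<rho>) * sq_dist_to ?\<rho>B (x - y') - \<delta> * (q \<bullet> y')) has_derivative
        (\<lambda>k. - 1 / (c * \<rho>) * ((2 *\<^sub>R (x - y' - closest_point ?\<rho>B (x - y'))) \<bullet> (- k)) - \<delta> * (q \<bullet> k))) (at y')"
      by (intro has_derivative_diff has_derivative_mult_right
          bounded_linear_imp_has_derivative bounded_linear_inner_right)
    then show "(\<beta>2 has_derivative (\<lambda>k. G2 y' \<bullet> k)) (at y')"
      by (simp add: \<beta>2_def[abs_def] G2_def inner_diff_left[of _ "\<delta> *\<^sub>R q"] mult_ac)
  qed
  have v_min: "local_min_on ({0<..<1} \<times> orthant)
      (\<lambda>z. v z - (\<lambda>(s, y). - (t - s)\<^sup>2 / (c * \<rho>) + \<beta>2 y) z) (s, y)"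
  proof (rule local_min_onI[where U = "UNIV \<times> ball 0 Y"])
    fix z :: "real \<times> (real^'d)" assume z: "z \<in> {0<..<1} \<times> orthant" "z \<in> UNIV \<times> ball 0 Y"
    obtain s' y' where z': "z = (s', y')" by (cases z)
    have "\<Phi> t x s' y' \<le> \<Phi> t x s y"
      using z t x by (intro max) (auto simp: z')
    then show "v (s, y) - (\<lambda>(s, y). - (t - s)\<^sup>2 / (c * \<rho>) + \<beta>2 y) (s, y) \<le>
        v z - (\<lambda>(s, y). - (t - s)\<^sup>2 / (c * \<rho>) + \<beta>2 y) z"
      by (simp add: z' \<Phi>_def \<beta>2_def add_divide_distrib)
  qed (use s01 y yY in \<open>auto intro!: open_Times\<close>)
  have G2_eq: "G2 y = p - \<delta> *\<^sub>R q" by (simp add: G2_def p_def)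
  have v_refl: "\<delta> \<le> G2 y \<bullet> \<gamma> i" if "y $ i = 0" for i
    using p_refl(2)[OF that] q[of i] by (simp add: G2_eq inner_diff_left)
  have "g (s, y) \<le> v (s, y) \<or> H (G2 y) \<le> - (2 * (t - s) / (c * \<rho>))"
    using viscosity_supersolution_inequality[OF v v_test s01 y(1) t1(4) v_min _ \<delta>] v_refl by auto
  then show False
  proof
    \<comment> \<open>If the obstacle is active for \<open>v\<close>, the gap is bounded by the oscillation of \<open>g\<close>.\<close>
    assume "g (s, y) \<le> v (s, y)"
    with u_le gap' have "g (t, x) - g (s, y) > \<sigma> / 2" by linarith
    moreover have "dist (t, x) (s, y) < \<mu>"
      using norm_Pair_le[of "t - s" "x - y"] dist_lt \<rho>(4) by (simp add: dist_norm)
    then have "dist (g (t, x)) (g (s, y)) < \<sigma> / 2"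
      using ivl xo y xX b by (intro \<mu>(2)) (auto simp: Y_def)
    ultimately show False unfolding dist_real_def by linarith
  next
    \<comment> \<open>Otherwise the two equations subtract; the time derivatives of the gluing penalty cancel.\<close>
    assume "H (G2 y) \<le> - (2 * (t - s) / (c * \<rho>))"
    moreover have "\<eta> \<le> \<eta> / t\<^sup>2"
      using t_pos t \<eta> by (simp add: le_divide_eq power_le_one)
    ultimately have "H (G x) - H (G2 y) \<ge> \<eta>"
      using u_ineq by (simp add: \<alpha>'_def)
    moreover have "dist (H (G x)) (H (G2 y)) < \<eta>"
    proof -
      have "2 * A / R\<^sup>2 * norm (x - closest_point ?RB x) \<le> 2 * A / R\<^sup>2 * R"
        using A xR by (intro mult_left_mono) auto
      also have "\<dots> = 2 * A / R" using R by (simp add: power2_eq_square)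
      also have "\<dots> < \<kappa> / 4" using R by (simp add: field_simps)
      finally have growth: "norm ((2 * A / R\<^sup>2) *\<^sub>R (x - closest_point ?RB x)) < \<kappa> / 4"
        using A by simp
      have tilt: "norm (\<delta> *\<^sub>R q) \<le> \<kappa> / 8" using \<delta>q \<delta> by simp
      have "dist (G x) (G2 y) = norm ((2 * A / R\<^sup>2) *\<^sub>R (x - closest_point ?RB x) + (\<delta> *\<^sub>R q + \<delta> *\<^sub>R q))"
        by (simp add: G_eq G2_eq dist_norm algebra_simps)
      also have "\<dots> < \<kappa>"
        using growth tilt \<kappa> norm_triangle_ineq[of "(2 * A / R\<^sup>2) *\<^sub>R (x - closest_point ?RB x)" "\<delta> *\<^sub>R q + \<delta> *\<^sub>R q"]
          norm_triangle_ineq[of "\<delta> *\<^sub>R q" "\<delta> *\<^sub>R q"] by linarith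
      finally have "dist (G x) (G2 y) < \<kappa>0" using \<kappa> by linarith
      moreover have "norm (G x) \<le> 2 / c + 1"
        using growth tilt \<kappa> norm_p norm_triangle_ineq[of "p + (2 * A / R\<^sup>2) *\<^sub>R (x - closest_point ?RB x)" "\<delta> *\<^sub>R q"]
          norm_triangle_ineq[of p "(2 * A / R\<^sup>2) *\<^sub>R (x - closest_point ?RB x)"]
        unfolding G_eq by linarith
      moreover have "norm (G2 y) \<le> 2 / c + 1"
        using tilt \<kappa> norm_p norm_triangle_ineq4[of p "\<delta> *\<^sub>R q"] unfolding G2_eq by linarith
      ultimately show ?thesis by (intro \<kappa>0(2)) auto
    qed
    ultimately show False by (simp add: dist_real_def)
  qed
qed

section \<open>The comparison theorem\<close>

lemma continuous_on_MIN:
  fixes F :: "'i \<Rightarrow> 'a::topological_space \<Rightarrow> real"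
  assumes "finite I" "I \<noteq> {}" "\<And>j. j \<in> I \<Longrightarrow> continuous_on S (F j)"
  shows "continuous_on S (\<lambda>p. MIN j\<in>I. F j p)"
  using assms
proof (induction rule: finite_ne_induct)
  case (insert j I)
  then have "continuous_on S (\<lambda>p. min (F j p) (MIN j\<in>I. F j p))"
    by (intro continuous_intros) auto
  with insert show ?case by simp
qed simp

text \<open>Such a vector is the constant gradient of a linear perturbation that is strictly decreasing along
  all reflection directions simultaneously.\<close>

lemma independent_imp_inner_eq_minus_one:
  fixes \<gamma> :: "'d \<Rightarrow> real^'n"
  assumes "independent (range \<gamma>)"
  obtains q where "\<And>i. q \<bullet> \<gamma> i = -1"
proof -
  obtain F :: "real^'n \<Rightarrow> real" where F: "linear F" "\<And>x. x \<in> range \<gamma> \<Longrightarrow> F x = -1"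
    using linear_independent_extend[OF assms, of "\<lambda>_. -1 :: real"] by auto
  have "adjoint F 1 \<bullet> \<gamma> i = -1" for i
    using adjoint_works[OF F(1), of "\<gamma> i" 1] F(2) by (simp add: inner_commute)
  then show ?thesis by (rule that)
qed

theorem theorem2p3:
  fixes J :: nat
    and Hs :: "nat \<Rightarrow> real^'d \<Rightarrow> real"
    and H :: "real^'d \<Rightarrow> real"
    and f :: "real^'d \<Rightarrow> real"
    and g u v :: "real \<times> (real^'d) \<Rightarrow> real"
    and \<gamma> :: "'d::finite \<Rightarrow> real^'d"
  assumes "J \<ge> 1"
    and "\<And>j. j \<in> {1..J} \<Longrightarrow> convex_on UNIV (Hs j)"
    and "\<And>p. H p = (MIN j\<in>{1..J}. Hs j p)"
    and "bounded (f ` orthant)" and "continuous_on orthant f"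
    and "bounded (g ` ({0..1} \<times> orthant))" and "continuous_on ({0..1} \<times> orthant) g"
    and "inj \<gamma>" and "independent (range \<gamma>)"
    and "\<And>i. \<gamma> i \<bullet> axis i 1 = 1"
    and "\<exists>B. compact B \<and> convex B \<and> (\<forall>x\<in>B. - x \<in> B) \<and> 0 \<in> interior B \<and>
          (\<forall>z\<in>frontier B. \<forall>n. outward_normal B z n \<longrightarrow>
             (\<forall>i. (z \<bullet> axis i 1 \<ge> -1 \<longrightarrow> \<gamma> i \<bullet> n \<ge> 0) \<and>
                  (z \<bullet> axis i 1 \<le> 1 \<longrightarrow> \<gamma> i \<bullet> n \<le> 0)))"
    and "viscosity_subsolution H f g \<gamma> u"
    and "viscosity_supersolution H f g \<gamma> v"
  shows "\<forall>t\<in>{0..1}. \<forall>x\<in>orthant. u (t, x) \<le> v (t, x)"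
proof (intro ballI)
  fix t :: real and x :: "real^'d" assume t: "t \<in> {0..1}" and x: "x \<in> orthant"
  have "continuous_on UNIV (\<lambda>p. MIN j\<in>{1..J}. Hs j p)"
    using assms(1,2) by (intro continuous_on_MIN convex_on_continuous) auto
  then have H: "continuous_on UNIV H" by (simp add: assms(3)[abs_def])
  obtain q where q: "\<And>i. q \<bullet> \<gamma> i = -1"
    using independent_imp_inner_eq_minus_one[OF assms(9)] by blast
  obtain B where B: "compact B" "convex B" "0 \<in> interior B" "oblique_normals \<gamma> B"
    using assms(11) unfolding oblique_normals_def by blast
  note comparison = comparison_positive_time[OF H assms(7) B q assms(12,13)]
  show "u (t, x) \<le> v (t, x)"
  proof (cases "t = 0")
    case False
    with t x show ?thesis by (intro comparison) auto
  next
    case True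
    have cu: "continuous_on ({0..1} \<times> orthant) u" and cv: "continuous_on ({0..1} \<times> orthant) v"
      using assms(12,13) unfolding viscosity_subsolution_def viscosity_supersolution_def bounded_lipschitz_def
      by (auto intro: lipschitz_on_continuous_on)
    have line: "continuous_on {0..1::real} (\<lambda>t. (t, x))" "(\<lambda>t. (t, x)) ` {0..1} \<subseteq> {0..1::real} \<times> orthant"
      using x by (auto intro!: continuous_intros)
    have "continuous_on {0..1} (\<lambda>t. v (t, x) - u (t, x))"
      by (intro continuous_on_diff continuous_on_compose2[OF cu line] continuous_on_compose2[OF cv line])
    moreover have "{0<..1::real} \<subseteq> {0..1}" "closure {0<..1::real} = {0..1}" by auto
    ultimately have "v (t, x) - u (t, x) \<ge> 0"
      using t comparison[OF _ _ x] by (intro continuous_ge_on_closure[of "{0<..1}" "\<lambda>t. v (t, x) - u (t, x)" t]) auto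
    then show ?thesis by simp
  qed
qed

end
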